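(* Let $K_1\subset\mathbb{R}^{n_1}$ and $K_2\subset\mathbb{R}^{n_2}$ be nontrivial closed convex pointed cones with $0\notin\operatorname{cl}\operatorname{aff}(E_{K_1})$ and $0\notin\operatorname{cl}\operatorname{aff}(E_{K_2})$. For $\ell=1,2$ let $d_\ell:=-P_{\operatorname{cl}\operatorname{aff}(E_{K_\ell})}(0)$ and $\delta_\ell:=\|d_\ell\|^2$. Then $K_1\times K_2\subset\mathbb{R}^{n_1+n_2}$ satisfies $0\notin\operatorname{cl}\operatorname{aff}(E_{K_1\times K_2})$, and its circumcentric direction $d:=-P_{\operatorname{cl}\operatorname{aff}(E_{K_1\times K_2})}(0)$ is $$d=\Bigl(\frac{\delta_2}{\delta_1+\delta_2}\,d_1,\ \frac{\delta_1}{\delta_1+\delta_2}\,d_2\Bigr),$$ with squared norm given by $$\frac{1}{\|d\|^2}=\frac{1}{\delta_1}+\frac{1}{\delta_2}.$$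
   Context: All spaces carry the Euclidean inner product and norm. Nontrivial means $K\ne\{0\}$; pointed means $K\cap(-K)=\{0\}$. The extremal section of a closed convex cone $K\subset\mathbb{R}^n$ is $E_K:=\{u\in\mathbb{R}^n:\|u\|=1,\ \mathbb{R}_+u\text{ is an extreme ray of }K\}$. $\operatorname{cl}\operatorname{aff}(E_K)$ is the closure of the affine hull of $E_K$ and $P_A$ denotes orthogonal projection onto a nonempty closed affine set $A$. *)

theory Defs
  imports "HOL-Analysis.Analysis"
begin

(* An extreme ray is a face that is a half-line emanating from the origin;
   here \<real>\<^sub>+ = [0, \<infinity>), so the apex belongs to the ray. *)
definition extreme_ray_of :: "'a::euclidean_space set \<Rightarrow> 'a set \<Rightarrow> bool" (infixr "extreme'_ray'_of" 50)
  where "R extreme_ray_of K \<longleftrightarrow>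
    R face_of K \<and> (\<exists>u. u \<noteq> 0 \<and> R = {t *\<^sub>R u | t. 0 \<le> t})"

definition extremal_section :: "'a::euclidean_space set \<Rightarrow> 'a set"
  where "extremal_section K = {u. norm u = 1 \<and> {t *\<^sub>R u | t. 0 \<le> t} extreme_ray_of K}"

(* As the library's closest_point is total, this value is meaningful only if K has an extreme ray,
   which every nontrivial closed convex pointed cone does. *)
definition circumcentric_direction :: "'a::euclidean_space set \<Rightarrow> 'a"
  where "circumcentric_direction K =
    - closest_point (closure (affine hull extremal_section K)) 0"

end

theory Submission imports Defs begin

text \<open>The extreme rays of \<open>K1 \<times> K2\<close> are those of the two factors, embedded along the coordinate
  axes. The projection of \<open>0\<close> onto the affine hull of a set \<open>E\<close> is the only point \<open>c\<close> of that hull with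
  \<open>c \<bullet> x = c \<bullet> c\<close> for every \<open>x \<in> E\<close>. The convex combination of \<open>(p1, 0)\<close> and \<open>(0, p2)\<close> that equalises
  the inner products with the two embedded sections therefore is the projection for the product.\<close>

section \<open>Pointed cones and positive functionals\<close>

text \<open>If a convex combination of two nonzero points vanished, its two terms would be negatives
  of each other inside \<open>K\<close>, so pointedness would make both zero, although one weight is
  positive.\<close>

lemma convex_pointed_cone_minus_0:
  fixes K :: "'a::real_vector set"
  assumes "convex K" "cone K" and pointed: "K \<inter> uminus ` K = {0}"
  shows "convex (K - {0})"
proof (rule convexI)
  fix x y :: 'a and u v :: real
  assume xy: "x \<in> K - {0}" "y \<in> K - {0}" and uv: "0 \<le> u" "0 \<le> v" "u + v = 1"
  have "u *\<^sub>R x + v *\<^sub>R y \<noteq> 0"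
  proof
    assume "u *\<^sub>R x + v *\<^sub>R y = 0"
    then have eq: "u *\<^sub>R x = - (v *\<^sub>R y)"
      by (simp add: eq_neg_iff_add_eq_0)
    moreover have "u *\<^sub>R x \<in> K" "v *\<^sub>R y \<in> K"
      using xy uv \<open>cone K\<close> by (auto simp: cone_def)
    ultimately have "u *\<^sub>R x \<in> K \<inter> uminus ` K"
      by auto
    then have "u *\<^sub>R x = 0"
      using pointed by blast
    with eq xy uv show False
      by auto
  qed
  then show "u *\<^sub>R x + v *\<^sub>R y \<in> K - {0}"
    using xy uv \<open>convex K\<close> by (auto simp: convex_def)
qed

text \<open>Needed for products: a ray \<open>R\<close> of one factor enters the product as
  \<open>R \<times> {0}\<close>, which is a face because \<open>{0}\<close> is a face of the other
  factor.\<close>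

lemma zero_face_of_pointed_cone:
  fixes K :: "'a::euclidean_space set"
  assumes "convex K" "cone K" "K \<inter> uminus ` K = {0}"
  shows "{0} face_of K"
  using convex_pointed_cone_minus_0[OF assms] assms
  by (auto simp: face_of_singleton extreme_point_of_stillconvex)

text \<open>The hull of the unit vectors of \<open>K\<close> is compact and misses \<open>0\<close>,
  so a hyperplane separates it strictly from \<open>0\<close>; homogeneity extends the bound to
  \<open>K\<close>. The uniform \<open>b\<close> later bounds the base cut out by
  \<open>a\<close>.\<close>

lemma pointed_cone_positive_functional:
  fixes K :: "'a::euclidean_space set"
  assumes "closed K" "convex K" "cone K" "K \<inter> uminus ` K = {0}"
  obtains a b where "0 < b" "\<And>x. x \<in> K \<Longrightarrow> b * norm x \<le> a \<bullet> x"
proof -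
  define C where "C = convex hull (K \<inter> sphere 0 1)"
  have "compact C"
    unfolding C_def using \<open>closed K\<close> by (intro compact_convex_hull) (simp add: closed_Int_compact)
  moreover have "C \<subseteq> K - {0}"
    unfolding C_def by (rule hull_minimal) (use convex_pointed_cone_minus_0 assms in auto)
  ultimately obtain a b where ab: "0 < b" "\<And>x. x \<in> C \<Longrightarrow> b < a \<bullet> x"
    using separating_hyperplane_closed_0[of C] by (metis C_def Diff_iff compact_imp_closed
        convex_convex_hull insertI1 subset_iff)
  have "b * norm x \<le> a \<bullet> x" if "x \<in> K" for x
  proof (cases "x = 0")
    case False
    then have "(1 / norm x) *\<^sub>R x \<in> K \<inter> sphere 0 1"
      using that \<open>cone K\<close> by (auto simp: cone_def)
    then have "b < a \<bullet> ((1 / norm x) *\<^sub>R x)"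
      using ab(2) unfolding C_def by (meson hull_inc)
    then show ?thesis
      using False by (simp add: field_simps)
  qed auto
  with ab(1) show ?thesis
    using that by blast
qed

section \<open>Existence of extreme rays\<close>

text \<open>Rescaling the endpoints of a segment that meets the ray moves them into the base
  \<open>a \<bullet> x = 1\<close>, where extremality of \<open>e\<close> makes them coincide with
  \<open>e\<close>.\<close>

lemma extreme_point_of_base_imp_face:
  fixes K :: "'a::euclidean_space set"
  assumes "convex K" "cone K" and pos: "\<And>x. \<lbrakk>x \<in> K; x \<noteq> 0\<rbrakk> \<Longrightarrow> 0 < a \<bullet> x"
    and e: "e extreme_point_of {x \<in> K. a \<bullet> x = 1}"
  shows "{t *\<^sub>R e | t. 0 \<le> t} face_of K"
proof -
  let ?R = "{t *\<^sub>R e | t. 0 \<le> t}"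
  have eK: "e \<in> K" "a \<bullet> e = 1"
    and ext: "\<And>x y. \<lbrakk>x \<in> K; a \<bullet> x = 1; y \<in> K; a \<bullet> y = 1\<rbrakk> \<Longrightarrow> e \<notin> open_segment x y"
    using e by (auto simp: extreme_point_of_def)
  have "?R \<subseteq> K"
    using eK \<open>cone K\<close> by (auto simp: cone_def)
  moreover have "convex ?R"
  proof (rule convexI)
    fix x y :: 'a and u v :: real
    assume "x \<in> ?R" "y \<in> ?R" and uv: "0 \<le> u" "0 \<le> v"
    then obtain s t where "x = s *\<^sub>R e" "y = t *\<^sub>R e" "0 \<le> s" "0 \<le> t"
      by blast
    then have "u *\<^sub>R x + v *\<^sub>R y = (u * s + v * t) *\<^sub>R e" "0 \<le> u * s + v * t"
      using uv by (auto simp: algebra_simps)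
    then show "u *\<^sub>R x + v *\<^sub>R y \<in> ?R"
      by blast
  qed
  moreover have "x \<in> ?R \<and> y \<in> ?R" if xy: "x \<in> K" "y \<in> K" and z: "z \<in> ?R" "z \<in> open_segment x y" for x y z
  proof -
    obtain s where s: "0 < s" "s < 1" "z = (1 - s) *\<^sub>R x + s *\<^sub>R y"
      using z by (auto simp: in_segment)
    obtain t where t: "0 \<le> t" "z = t *\<^sub>R e"
      using z by auto
    have at: "t = (1 - s) * (a \<bullet> x) + s * (a \<bullet> y)"
      using s t eK by (metis inner_add_right inner_scaleR_right mult.right_neutral)
    \<comment> \<open>A zero endpoint cannot be rescaled into the base; in that case
      \<open>z\<close> is a positive multiple of the other endpoint.\<close>
    consider "x = 0" | "y = 0" | "x \<noteq> 0" "y \<noteq> 0" by blast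
    then show ?thesis
    proof cases
      case 1
      then have "y = (t / s) *\<^sub>R e"
        using s t by (simp add: eq_vector_fraction_iff)
      moreover have "0 \<le> t / s"
        using s t by simp
      moreover have "x = 0 *\<^sub>R e"
        using 1 by simp
      ultimately show ?thesis
        by blast
    next
      case 2
      then have "x = (t / (1 - s)) *\<^sub>R e"
        using s t by (simp add: eq_vector_fraction_iff)
      moreover have "0 \<le> t / (1 - s)"
        using s t by simp
      moreover have "y = 0 *\<^sub>R e"
        using 2 by simp
      ultimately show ?thesis
        by blast
    next
      case 3
      define p q where "p = a \<bullet> x" and "q = a \<bullet> y"
      have pq: "0 < p" "0 < q"
        using 3 xy pos by (auto simp: p_def q_def)
      have tpq: "t = (1 - s) * p + s * q"
        using at by (simp add: p_def q_def)
      then have "0 < t"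
        using pq s by (simp add: add_pos_pos)
      \<comment> \<open>Dividing \<open>z\<close> by \<open>t\<close> gives \<open>e\<close>;
        rewritten in terms of \<open>x'\<close> and \<open>y'\<close>, the weights become
        \<open>(1 - s) * p / t\<close> and \<open>s * q / t\<close>, which sum to 1 by
        \<open>tpq\<close>.\<close>
      define x' y' r where "x' = (1 / p) *\<^sub>R x" and "y' = (1 / q) *\<^sub>R y" and "r = s * q / t"
      have x'y': "x' \<in> K" "a \<bullet> x' = 1" "y' \<in> K" "a \<bullet> y' = 1"
        using pq xy \<open>cone K\<close> by (auto simp: x'_def y'_def cone_def p_def q_def)
      have r: "0 < r" "r < 1"
        using pq s \<open>0 < t\<close> tpq by (auto simp: r_def)
      have "1 - r = (1 - s) * p / t"
        using \<open>0 < t\<close> tpq by (simp add: r_def field_simps)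
      then have "(1 - r) *\<^sub>R x' + r *\<^sub>R y' = (1 / t) *\<^sub>R z"
        using pq by (simp add: s(3) x'_def y'_def r_def scaleR_right_distrib)
      also have "\<dots> = e"
        using t \<open>0 < t\<close> by simp
      finally have er: "e = (1 - r) *\<^sub>R x' + r *\<^sub>R y'" ..
      have "x' = y'"
        using ext[OF x'y'] er r by (auto simp: in_segment)
      with er have "x' = e" "y' = e"
        by (auto simp: algebra_simps)
      moreover have "x = p *\<^sub>R x'" "y = q *\<^sub>R y'"
        using pq by (simp_all add: x'_def y'_def)
      ultimately have "x = p *\<^sub>R e" "y = q *\<^sub>R e"
        by simp_all
      with pq show ?thesis
        by (metis (mono_tags, lifting) less_imp_le mem_Collect_eq)
    qed
  qed
  ultimately show ?thesis
    unfolding face_of_def by blast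
qed

lemma extremal_section_iff:
  "u \<in> extremal_section K \<longleftrightarrow> norm u = 1 \<and> {t *\<^sub>R u | t. 0 \<le> t} face_of K"
proof -
  have "norm u = 1 \<Longrightarrow> u \<noteq> 0"
    by auto
  then show ?thesis
    unfolding extremal_section_def extreme_ray_of_def by blast
qed

text \<open>Ensures that the projections below really lie in the affine hulls. A compact convex base
  of \<open>K\<close> has an extreme point, which spans an extreme ray.\<close>

lemma extremal_section_nonempty:
  fixes K :: "'a::euclidean_space set"
  assumes "closed K" "convex K" "cone K" "K \<inter> uminus ` K = {0}" "K \<noteq> {0}"
  shows "extremal_section K \<noteq> {}"
proof -
  obtain a b where ab: "0 < b" "\<And>x. x \<in> K \<Longrightarrow> b * norm x \<le> a \<bullet> x"
    using pointed_cone_positive_functional[OF assms(1-4)] by blast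
  have pos: "0 < a \<bullet> x" if "x \<in> K" "x \<noteq> 0" for x
    using ab that by (smt (verit) mult_pos_pos zero_less_norm_iff)
  define B where "B = {x \<in> K. a \<bullet> x = 1}"
  have B: "B = K \<inter> {x. a \<bullet> x = 1}"
    by (auto simp: B_def)
  have "norm x \<le> 1 / b" if "x \<in> B" for x
    using ab that by (fastforce simp: B_def field_simps)
  then have "compact B"
    unfolding compact_eq_bounded_closed using \<open>closed K\<close>
    by (auto simp: bounded_iff B closed_hyperplane)
  moreover have "convex B"
    unfolding B using \<open>convex K\<close> by (simp add: convex_Int convex_hyperplane)
  moreover obtain x where x: "x \<in> K" "x \<noteq> 0"
    using assms by blast
  then have "(1 / (a \<bullet> x)) *\<^sub>R x \<in> B"
    using pos[OF x] \<open>cone K\<close> by (auto simp: B_def cone_def)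
  ultimately obtain e where e: "e extreme_point_of B"
    using extreme_point_exists_convex by blast
  then have "e \<noteq> 0"
    by (auto simp: B_def extreme_point_of_def)
  \<comment> \<open>\<open>e\<close> is normalised by \<open>a\<close>, not by the norm; rescaling
    it to unit length leaves the ray unchanged.\<close>
  define u where "u = (1 / norm e) *\<^sub>R e"
  have "{t *\<^sub>R u | t. 0 \<le> t} = {t *\<^sub>R e | t. 0 \<le> t}"
  proof (intro equalityI subsetI)
    fix z assume "z \<in> {t *\<^sub>R u | t. 0 \<le> t}"
    then obtain t where "0 \<le> t" "z = (t / norm e) *\<^sub>R e"
      by (auto simp: u_def)
    then show "z \<in> {t *\<^sub>R e | t. 0 \<le> t}"
      using \<open>e \<noteq> 0\<close> by (auto intro!: exI[of _ "t / norm e"])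
  next
    fix z assume "z \<in> {t *\<^sub>R e | t. 0 \<le> t}"
    then obtain t where "0 \<le> t" "z = (t * norm e) *\<^sub>R u"
      using \<open>e \<noteq> 0\<close> by (auto simp: u_def)
    then show "z \<in> {t *\<^sub>R u | t. 0 \<le> t}"
      by (auto intro!: exI[of _ "t * norm e"])
  qed
  moreover have "{t *\<^sub>R e | t. 0 \<le> t} face_of K"
    using extreme_point_of_base_imp_face pos e assms unfolding B_def by blast
  moreover have "norm u = 1"
    using \<open>e \<noteq> 0\<close> by (simp add: u_def)
  ultimately have "u \<in> extremal_section K"
    by (simp add: extremal_section_iff)
  then show ?thesis
    by blast
qed

section \<open>Extreme rays of a product\<close>

text \<open>Faces of a product are products of faces, and a ray can be a product
  \<open>F \<times> G\<close> only when it lies along one of the axes.\<close>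

lemma extremal_section_Times:
  fixes K1 :: "'a::euclidean_space set" and K2 :: "'b::euclidean_space set"
  assumes face1: "{0} face_of K1" and face2: "{0} face_of K2"
  shows "extremal_section (K1 \<times> K2) =
    (\<lambda>x. (x, 0)) ` extremal_section K1 \<union> (\<lambda>y. (0, y)) ` extremal_section K2"
proof (intro equalityI subsetI)
  fix w assume w: "w \<in> extremal_section (K1 \<times> K2)"
  obtain u v where uv: "w = (u, v)"
    by (cases w)
  have norm1: "norm (u, v) = 1"
    using w by (simp add: uv extremal_section_iff)
  obtain F G where FG: "F face_of K1" "G face_of K2" "{t *\<^sub>R (u, v) | t. 0 \<le> t} = F \<times> G"
    using w by (auto simp: uv extremal_section_iff face_of_Times_decomp)
  have mem: "x \<in> F \<and> y \<in> G \<longleftrightarrow> (\<exists>t\<ge>0. x = t *\<^sub>R u \<and> y = t *\<^sub>R v)" for x y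
    using FG(3) by (auto simp: set_eq_iff)
  have "u \<in> F" "0 \<in> F" "v \<in> G" "0 \<in> G"
    using mem[of u v] mem[of 0 0] by (auto intro: exI[of _ 1])
  \<comment> \<open>The product contains \<open>(u, 0)\<close>, so \<open>u = t *\<^sub>R u\<close>
    and \<open>0 = t *\<^sub>R v\<close> for some \<open>t\<close>: either \<open>v = 0\<close>, or
    \<open>t = 0\<close> and hence \<open>u = 0\<close>.\<close>
  then have "u = 0 \<or> v = 0"
    using mem[of u 0] by auto
  then show "w \<in> (\<lambda>x. (x, 0)) ` extremal_section K1 \<union> (\<lambda>y. (0, y)) ` extremal_section K2"
  proof
    assume "u = 0"
    then have "G = {t *\<^sub>R v | t. 0 \<le> t}"
      using mem[of 0] \<open>0 \<in> F\<close> by auto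
    with FG \<open>u = 0\<close> norm1 uv show ?thesis
      by (simp add: extremal_section_iff norm_Pair image_iff)
  next
    assume "v = 0"
    then have "F = {t *\<^sub>R u | t. 0 \<le> t}"
      using mem[of _ 0] \<open>0 \<in> G\<close> by auto
    with FG \<open>v = 0\<close> norm1 uv show ?thesis
      by (simp add: extremal_section_iff norm_Pair image_iff)
  qed
next
  fix w assume "w \<in> (\<lambda>x. (x, 0)) ` extremal_section K1 \<union> (\<lambda>y. (0, y)) ` extremal_section K2"
  then consider u where "w = (u, 0)" "u \<in> extremal_section K1"
    | v where "w = (0, v)" "v \<in> extremal_section K2"
    by auto
  then show "w \<in> extremal_section (K1 \<times> K2)"
  proof cases
    case 1
    have "{t *\<^sub>R w | t. 0 \<le> t} = {t *\<^sub>R u | t. 0 \<le> t} \<times> {0}"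
      by (auto simp: 1)
    with 1 face2 show ?thesis
      by (simp add: extremal_section_iff norm_Pair face_of_Times)
  next
    case 2
    have "{t *\<^sub>R w | t. 0 \<le> t} = {0} \<times> {t *\<^sub>R v | t. 0 \<le> t}"
      by (auto simp: 2)
    with 2 face1 show ?thesis
      by (simp add: extremal_section_iff norm_Pair face_of_Times)
  qed
qed

section \<open>Projection of the origin onto affine hulls\<close>

lemma inner_eq_on_affine_hull:
  fixes c :: "'a::real_inner"
  assumes "\<And>x. x \<in> E \<Longrightarrow> c \<bullet> x = r" and "y \<in> affine hull E"
  shows "c \<bullet> y = r"
proof -
  have "affine hull E \<subseteq> {x. c \<bullet> x = r}"
    using assms(1) by (intro hull_minimal) (auto simp: affine_hyperplane)
  with assms(2) show ?thesis
    by blast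
qed

text \<open>The inner product with \<open>c\<close> is constant on the hull, so Cauchy-Schwarz
  bounds \<open>norm c\<close> by the norm of every other point. The next lemma gives the
  converse.\<close>

lemma closest_point_affine_hull_0_eqI:
  fixes c :: "'a::euclidean_space"
  assumes "c \<in> affine hull E" and "\<And>x. x \<in> E \<Longrightarrow> c \<bullet> x = c \<bullet> c"
  shows "closest_point (affine hull E) 0 = c"
proof -
  have "dist 0 c \<le> dist 0 y" if "y \<in> affine hull E" for y
  proof -
    have "c \<bullet> y = c \<bullet> c"
      using inner_eq_on_affine_hull[OF assms(2) that] by simp
    then have "norm c * norm c \<le> norm c * norm y"
      by (metis norm_cauchy_schwarz power2_eq_square power2_norm_eq_inner)
    then show ?thesis
      by (cases "c = 0") auto
  qed
  then show ?thesis
    using closest_point_unique[of "affine hull E" c 0] assms(1)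
    by (auto simp: affine_imp_convex)
qed

lemma closest_point_affine_0:
  fixes A :: "'a::euclidean_space set"
  assumes "affine A" "closed A" "x \<in> A"
  shows "closest_point A 0 \<bullet> x = closest_point A 0 \<bullet> closest_point A 0"
proof -
  define c where "c = closest_point A 0"
  have "c \<in> A"
    unfolding c_def using assms by (intro closest_point_in_set) auto
  \<comment> \<open>With \<open>x\<close> also its reflection in \<open>c\<close> lies in \<open>A\<close>, which turns the variational inequality into an equation.\<close>
  have "2 *\<^sub>R c - x \<in> A"
    using mem_affine[OF \<open>affine A\<close> \<open>c \<in> A\<close> \<open>x \<in> A\<close>, of 2 "-1"] by simp
  then have "(0 - c) \<bullet> (2 *\<^sub>R c - x - c) \<le> 0"
    unfolding c_def using assms by (intro closest_point_dot) (auto simp: affine_imp_convex)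
  moreover have "(0 - c) \<bullet> (x - c) \<le> 0"
    unfolding c_def using assms by (intro closest_point_dot) (auto simp: affine_imp_convex)
  ultimately show ?thesis
    unfolding c_def by (simp add: inner_diff_right)
qed

text \<open>With weights \<open>s\<close> and \<open>1 - s\<close> on \<open>(p1, 0)\<close> and
  \<open>(0, p2)\<close>, the inner products with the two embedded sets are \<open>s * r1\<close>
  and \<open>(1 - s) * r2\<close>; equating them forces \<open>s = r2 / (r1 + r2)\<close>.\<close>

lemma closest_point_affine_hull_axes:
  fixes E1 :: "'a::euclidean_space set" and E2 :: "'b::euclidean_space set"
  defines "p1 \<equiv> closest_point (affine hull E1) 0" and "p2 \<equiv> closest_point (affine hull E2) 0"
  defines "r1 \<equiv> p1 \<bullet> p1" and "r2 \<equiv> p2 \<bullet> p2"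
  defines "H \<equiv> affine hull ((\<lambda>x. (x, 0)) ` E1 \<union> (\<lambda>y. (0, y)) ` E2)"
  assumes ne: "E1 \<noteq> {}" "E2 \<noteq> {}" and nz: "0 \<notin> affine hull E1" "0 \<notin> affine hull E2"
  shows "0 \<notin> H"
    and "closest_point H 0 = ((r2 / (r1 + r2)) *\<^sub>R p1, (r1 / (r1 + r2)) *\<^sub>R p2)"
proof -
  have p: "p1 \<in> affine hull E1" "p2 \<in> affine hull E2"
    unfolding p1_def p2_def using ne by (auto intro!: closest_point_in_set)
  then have r: "0 < r1" "0 < r2"
    unfolding r1_def r2_def using nz by auto
  define c where "c = ((r2 / (r1 + r2)) *\<^sub>R p1, (r1 / (r1 + r2)) *\<^sub>R p2)"
  \<comment> \<open>The common value of these inner products, which is also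
    \<open>c \<bullet> c\<close>.\<close>
  define m where "m = r1 * r2 / (r1 + r2)"
  have in1: "p1 \<bullet> x = r1" if "x \<in> E1" for x
    unfolding r1_def p1_def using that by (intro closest_point_affine_0) (auto intro: hull_inc)
  have in2: "p2 \<bullet> y = r2" if "y \<in> E2" for y
    unfolding r2_def p2_def using that by (intro closest_point_affine_0) (auto intro: hull_inc)
  have cm: "c \<bullet> z = m" if "z \<in> (\<lambda>x. (x, 0)) ` E1 \<union> (\<lambda>y. (0, y)) ` E2" for z
    using that in1 in2 by (auto simp: c_def m_def mult.commute)
  \<comment> \<open>The axis embeddings are linear and so commute with affine hulls, which places
    both embedded projections in \<open>H\<close>.\<close>
  have "bounded_linear (\<lambda>x::'a. (x, 0::'b))" "bounded_linear (\<lambda>y::'b. (0::'a, y))"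
    by (intro bounded_linear_intros)+
  note this[THEN affine_hull_linear_image, symmetric]
  then have "(p1, 0) \<in> affine hull ((\<lambda>x. (x, 0::'b)) ` E1)"
    and "(0, p2) \<in> affine hull ((\<lambda>y. (0::'a, y)) ` E2)"
    using p by simp_all
  then have "(p1, 0) \<in> H" "(0, p2) \<in> H"
    unfolding H_def by (meson Un_upper1 Un_upper2 hull_mono subsetD)+
  moreover have "r2 / (r1 + r2) + r1 / (r1 + r2) = 1"
    using r by (simp add: add_divide_distrib[symmetric] add.commute)
  ultimately have "(r2 / (r1 + r2)) *\<^sub>R (p1, 0) + (r1 / (r1 + r2)) *\<^sub>R (0, p2) \<in> H"
    unfolding H_def by (intro mem_affine) auto
  then have "c \<in> H"
    by (simp add: c_def)
  have cH: "c \<bullet> z = m" if "z \<in> H" for z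
    using inner_eq_on_affine_hull[OF cm] that unfolding H_def by blast
  have "0 < m"
    using r by (simp add: m_def)
  \<comment> \<open>\<open>H\<close> lies in the hyperplane \<open>c \<bullet> z = m\<close>, which
    misses \<open>0\<close> as \<open>m\<close> is positive.\<close>
  with cH[of 0] show "0 \<notin> H"
    by auto
  show "closest_point H 0 = ((r2 / (r1 + r2)) *\<^sub>R p1, (r1 / (r1 + r2)) *\<^sub>R p2)"
    unfolding c_def[symmetric] H_def
    by (rule closest_point_affine_hull_0_eqI) (use \<open>c \<in> H\<close> cm cH[OF \<open>c \<in> H\<close>] in \<open>auto simp: H_def\<close>)
qed

section \<open>The circumcentric direction of the product\<close>

theorem proposition6p10:
  fixes K1 :: "'a::euclidean_space set" and K2 :: "'b::euclidean_space set"
    and d1 :: 'a and d2 :: 'b and d :: "'a \<times> 'b" and \<delta>1 \<delta>2 :: real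
  assumes "closed K1" and "convex K1" and "cone K1"
    and "K1 \<inter> uminus ` K1 = {0}" and "K1 \<noteq> {0}"
    and "closed K2" and "convex K2" and "cone K2"
    and "K2 \<inter> uminus ` K2 = {0}" and "K2 \<noteq> {0}"
    and "0 \<notin> closure (affine hull extremal_section K1)"
    and "0 \<notin> closure (affine hull extremal_section K2)"
    and "d1 = circumcentric_direction K1" and "\<delta>1 = (norm d1)\<^sup>2"
    and "d2 = circumcentric_direction K2" and "\<delta>2 = (norm d2)\<^sup>2"
    and "d = circumcentric_direction (K1 \<times> K2)"
  shows "0 \<notin> closure (affine hull extremal_section (K1 \<times> K2))
    \<and> d = ((\<delta>2 / (\<delta>1 + \<delta>2)) *\<^sub>R d1, (\<delta>1 / (\<delta>1 + \<delta>2)) *\<^sub>R d2)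
    \<and> 1 / (norm d)\<^sup>2 = 1 / \<delta>1 + 1 / \<delta>2"
proof -
  let ?E1 = "extremal_section K1" and ?E2 = "extremal_section K2"
  have ne: "?E1 \<noteq> {}" "?E2 \<noteq> {}"
    using assms by (auto dest: extremal_section_nonempty)
  have nz: "0 \<notin> affine hull ?E1" "0 \<notin> affine hull ?E2"
    using assms by auto
  have d12: "d1 = - closest_point (affine hull ?E1) 0" "d2 = - closest_point (affine hull ?E2) 0"
    using assms by (simp_all add: circumcentric_direction_def)
  have \<delta>12: "\<delta>1 = d1 \<bullet> d1" "\<delta>2 = d2 \<bullet> d2"
    using assms by (simp_all add: power2_norm_eq_inner)
  have "closest_point (affine hull ?E1) 0 \<in> affine hull ?E1"
    "closest_point (affine hull ?E2) 0 \<in> affine hull ?E2"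
    using ne by (auto intro!: closest_point_in_set)
  then have \<delta>_pos: "0 < \<delta>1" "0 < \<delta>2"
    using nz d12 \<delta>12 by (metis inner_gt_zero_iff neg_0_equal_iff_equal)+
  have sec: "extremal_section (K1 \<times> K2) = (\<lambda>x. (x, 0)) ` ?E1 \<union> (\<lambda>y. (0, y)) ` ?E2"
    using assms by (intro extremal_section_Times zero_face_of_pointed_cone)
  \<comment> \<open>Affine hulls are closed in finite dimension, so taking the closure changes
    nothing.\<close>
  have notin: "0 \<notin> closure (affine hull extremal_section (K1 \<times> K2))"
    using closest_point_affine_hull_axes(1)[OF ne nz] by (simp add: sec)
  \<comment> \<open>Negating the projections leaves their squared norms, and hence the weights,
    unchanged.\<close>
  have d: "d = ((\<delta>2 / (\<delta>1 + \<delta>2)) *\<^sub>R d1, (\<delta>1 / (\<delta>1 + \<delta>2)) *\<^sub>R d2)"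
    using closest_point_affine_hull_axes(2)[OF ne nz] assms(17)
    by (simp add: circumcentric_direction_def sec \<delta>12 d12)
  have "(norm d)\<^sup>2 = (\<delta>2 / (\<delta>1 + \<delta>2))\<^sup>2 * \<delta>1 + (\<delta>1 / (\<delta>1 + \<delta>2))\<^sup>2 * \<delta>2"
    unfolding d power2_norm_eq_inner \<delta>12 by (simp add: power2_eq_square)
  also have "\<dots> = \<delta>1 * \<delta>2 * (\<delta>1 + \<delta>2) / (\<delta>1 + \<delta>2)\<^sup>2"
    by (simp add: power_divide add_divide_distrib[symmetric] power2_eq_square algebra_simps)
  also have "\<dots> = \<delta>1 * \<delta>2 / (\<delta>1 + \<delta>2)"
    by (simp add: power2_eq_square)
  finally have "1 / (norm d)\<^sup>2 = (\<delta>1 + \<delta>2) / (\<delta>1 * \<delta>2)"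
    by simp
  also have "\<dots> = 1 / \<delta>1 + 1 / \<delta>2"
    using \<delta>_pos by (simp add: field_simps)
  finally have "1 / (norm d)\<^sup>2 = 1 / \<delta>1 + 1 / \<delta>2" .
  with notin d show ?thesis
    by blast
qed

end
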